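(* Consider a given reference data set $\bar\omega_{\bar N}$, with $\bar\omega^I_{\bar N}:=\{x\in\bar\omega_{\bar N}:x\in O_{t^*(\omega_N)}\}$ and $\bar\omega^O_{\bar N}:=\{x\in\bar\omega_{\bar N}:x\notin O_{t^*(\omega_N)}\}$. Let a set of $N_\delta$ points, denoted by $\tilde\omega_{N_\delta}$, be randomly extracted according to $\mathbb{P}$ over $X$. Let $\delta^*(\tilde\omega_{N_\delta};\bar\omega_{\bar N})$ be obtained by solving the sampled problem $$\min_{\delta\ge 0}\ \delta\quad\text{s.t.}\quad h(x)\le\delta\ \ \forall x\in\tilde\omega_{N_\delta}.$$ For any $\tilde\epsilon>0$, let $\beta_\delta=(1-\tilde\epsilon)^{N_\delta}$. Then it holds that $$\mathbb{P}^{N_\delta}\big\{\tilde\omega_{N_\delta}\in X^{N_\delta}:\ \mathbb{P}\{\underline{\chi}\}-\tilde\epsilon\le\mathbb{P}\{O_{t^*(\omega_N)}\}\le\mathbb{P}\{\overline{\chi}\}+\tilde\epsilon\big\}\ge 1-\beta_\delta,$$ where $$\overline{\chi}:=O_{t^*(\omega_N)}\cap\Pi\big(\bar\omega^I_{\bar N},\bar\omega^O_{\bar N},\delta^*(\tilde\omega_{N_\delta};\bar\omega_{\bar N})\big),\qquad \underline{\chi}:=O_{t^*(\omega_N)}\cup\Pi\big(\bar\omega^I_{\bar N},\bar\omega^O_{\bar N},-\delta^*(\tilde\omega_{N_\delta};\bar\omega_{\bar N})\big).$$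
   Context: $\mathbb{Z}^+$ denotes the set of non-negative integers. Consider the discrete-time system $x(t+1)=f(x(t))$, $t\in\mathbb{Z}^+$, where $f:\mathbb{R}^n\to\mathbb{R}^n$ is continuous, with constraint set $X\subseteq\mathbb{R}^n$, which is compact. $\phi(t,x)$ denotes the solution at time $t$ with initial condition $x$ at time $0$. $\mathbb{P}$ is the uniform probability measure on the Borel $\sigma$-algebra of $X$, and $\mathbb{P}^{N_\delta}$ is the probability measure on $X^{N_\delta}$ of the i.i.d. multi-sample extraction $\tilde\omega_{N_\delta}$. $\|\cdot\|$ is the norm on $\mathbb{R}^n$. For $k\in\mathbb{Z}^+$ let $O_k:=\{x\in X:\phi(\ell,x)\in X\text{ for all }\ell\in\{1,\dots,k\}\}$ (so $O_0=X$). For $x\in X$ let $t^*(x):=\min\{t\in\mathbb{Z}^+:\phi(t,x)\notin X\}$, with $t^*(x):=0$ when $\phi(t,x)\in X$ for all $t\in\mathbb{Z}^+$. For a given set $\omega_N=\{x_1,\dots,x_N\}$ of $N$ initial states in $X$, $t^*(\omega_N):=\max_{x\in\omega_N}t^*(x)$. The reference data set $\bar\omega_{\bar N}$ is a set of $\bar N$ initial states in $X$. Here $\omega_N$ and $\bar\omega_{\bar N}$ are given, and the randomness is in $\tilde\omega_{N_\delta}$. For subsets $S_1,S_2\subseteq\mathbb{R}^n$ and $r\in\mathbb{R}$, $$\Pi(S_1,S_2,r):=\Big\{x\in X:\inf_{\tilde x\in S_1}\|\tilde x-x\|-\inf_{\tilde y\in S_2}\|\tilde y-x\|\le r\Big\}.$$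 The function $h$ on $X$ is $$h(x):=\mathbf{1}_{O_{t^*(\omega_N)}}(x)\,h^I(x)+\mathbf{1}_{X\setminus O_{t^*(\omega_N)}}(x)\,h^O(x),\quad h^I(x):=\min_{\tilde x\in\bar\omega^I_{\bar N}}\|\tilde x-x\|,\quad h^O(x):=\min_{\tilde y\in\bar\omega^O_{\bar N}}\|\tilde y-x\|,$$ where $\mathbf{1}_S$ denotes the indicator function of a set $S$.
   Formalization: Assumes β_δ ≥ 0: for ε̃ > 1 and odd N_δ, β_δ < 0 and the claim would require a probability above 1. Also assumes X has positive volume and that each minimum used in h is over a nonempty reference set, so that P and h are defined; the norm is Euclidean. *)

theory Defs
  imports "HOL-Probability.Probability"
begin

definition trajectory :: "('a \<Rightarrow> 'a) \<Rightarrow> nat \<Rightarrow> 'a \<Rightarrow> 'a" where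
  "trajectory f t x = (f ^^ t) x"

definition stay_set :: "('a \<Rightarrow> 'a) \<Rightarrow> 'a set \<Rightarrow> nat \<Rightarrow> 'a set" where
  "stay_set f X k = {x \<in> X. \<forall>l\<in>{1..k}. trajectory f l x \<in> X}"

definition exit_time :: "('a \<Rightarrow> 'a) \<Rightarrow> 'a set \<Rightarrow> 'a \<Rightarrow> nat" where
  "exit_time f X x =
    (if \<forall>t. trajectory f t x \<in> X then 0 else (LEAST t. trajectory f t x \<notin> X))"

definition max_exit_time :: "('a \<Rightarrow> 'a) \<Rightarrow> 'a set \<Rightarrow> 'a set \<Rightarrow> nat" where
  "max_exit_time f X \<omega> = Max (exit_time f X ` \<omega>)"

(* The set O_k at k = t*(\<omega>). *)
definition est_set :: "('a \<Rightarrow> 'a) \<Rightarrow> 'a set \<Rightarrow> 'a set \<Rightarrow> 'a set" where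
  "est_set f X \<omega> = stay_set f X (max_exit_time f X \<omega>)"

definition ref_in :: "('a \<Rightarrow> 'a) \<Rightarrow> 'a set \<Rightarrow> 'a set \<Rightarrow> 'a set \<Rightarrow> 'a set" where
  "ref_in f X \<omega> R = {x \<in> R. x \<in> est_set f X \<omega>}"

definition ref_out :: "('a \<Rightarrow> 'a) \<Rightarrow> 'a set \<Rightarrow> 'a set \<Rightarrow> 'a set \<Rightarrow> 'a set" where
  "ref_out f X \<omega> R = {x \<in> R. x \<notin> est_set f X \<omega>}"

(* The infima are taken in the extended reals, so that the infimum over an empty
   set is \<infinity>; one of the two sets is empty, for instance, when est_set f X \<omega> = X. *)
definition dist_cmp_set ::
    "'a::real_normed_vector set \<Rightarrow> 'a set \<Rightarrow> 'a set \<Rightarrow> real \<Rightarrow> 'a set" where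
  "dist_cmp_set X S1 S2 r =
    {x \<in> X. (INF y\<in>S1. ereal (norm (y - x))) - (INF y\<in>S2. ereal (norm (y - x))) \<le> ereal r}"

(* Min is unspecified on the empty set, but a summand whose indicator is 0 vanishes. *)
definition h_fun ::
    "('a::real_normed_vector \<Rightarrow> 'a) \<Rightarrow> 'a set \<Rightarrow> 'a set \<Rightarrow> 'a set \<Rightarrow> 'a \<Rightarrow> real" where
  "h_fun f X \<omega> R x =
    indicator (est_set f X \<omega>) x * Min ((\<lambda>y. norm (y - x)) ` ref_in f X \<omega> R) +
    indicator (X - est_set f X \<omega>) x * Min ((\<lambda>y. norm (y - x)) ` ref_out f X \<omega> R)"

definition delta_star ::
    "('a::real_normed_vector \<Rightarrow> 'a) \<Rightarrow> 'a set \<Rightarrow> 'a set \<Rightarrow> 'a set \<Rightarrow> 'a set \<Rightarrow> real" where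
  "delta_star f X \<omega> R S = (LEAST \<delta>. 0 \<le> \<delta> \<and> (\<forall>x\<in>S. h_fun f X \<omega> R x \<le> \<delta>))"

definition chi_upper ::
    "('a::real_normed_vector \<Rightarrow> 'a) \<Rightarrow> 'a set \<Rightarrow> 'a set \<Rightarrow> 'a set \<Rightarrow> 'a set \<Rightarrow> 'a set" where
  "chi_upper f X \<omega> R S = est_set f X \<omega> \<inter>
    dist_cmp_set X (ref_in f X \<omega> R) (ref_out f X \<omega> R) (delta_star f X \<omega> R S)"

definition chi_lower ::
    "('a::real_normed_vector \<Rightarrow> 'a) \<Rightarrow> 'a set \<Rightarrow> 'a set \<Rightarrow> 'a set \<Rightarrow> 'a set \<Rightarrow> 'a set" where
  "chi_lower f X \<omega> R S = est_set f X \<omega> \<union>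
    dist_cmp_set X (ref_in f X \<omega> R) (ref_out f X \<omega> R) (- delta_star f X \<omega> R S)"

(* A measure with space X; a probability measure if X has finite positive volume. *)
definition unif :: "'a::euclidean_space set \<Rightarrow> 'a measure" where
  "unif X = uniform_measure (restrict_space lborel X) X"

end

theory Submission
  imports Defs
begin

text \<open>
  A point of the estimate missing from the upper set, or of the lower set missing from the
  estimate, satisfies \<open>h x > \<delta>\<^sup>*\<close>, so it suffices that this event has
  probability at most \<open>\<epsilon>\<close>. The levels \<open>\<delta> \<ge> 0\<close> with \<open>P {h > \<delta>} > \<epsilon>\<close> form an initial segment
  \<open>B\<close> of the half line, and \<open>P {h \<in> B} \<le> 1 - \<epsilon>\<close>; if \<open>\<delta>\<^sup>*\<close> lies in \<open>B\<close> then so do all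
  the sampled values of \<open>h\<close>, which has probability at most \<open>(1 - \<epsilon>) ^ N\<close>.
\<close>

section \<open>Exceedance probabilities and the maximum of an i.i.d. sample\<close>

lemma (in prob_space) prob_exceedance_levels:
  fixes h :: "'a \<Rightarrow> real"
  assumes [measurable]: "h \<in> borel_measurable M" and "\<epsilon> \<le> 1"
  defines "B \<equiv> {d. \<epsilon> < prob {x \<in> space M. d < h x}}"
  shows "prob {x \<in> space M. h x \<in> B} \<le> 1 - \<epsilon>"
proof -
  define A where "A = {x \<in> space M. h x \<in> B}"
  have low: "prob {x \<in> space M. h x \<le> b} \<le> 1 - \<epsilon>" if "b \<in> B" for b
  proof -
    have "prob {x \<in> space M. h x \<le> b} = 1 - prob {x \<in> space M. \<not> h x \<le> b}"
      by (subst prob_neg) auto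
    then show ?thesis using that by (simp add: B_def not_le)
  qed
  have down: "c \<in> B" if "b \<in> B" "c \<le> b" for b c
  proof -
    have "prob {x \<in> space M. b < h x} \<le> prob {x \<in> space M. c < h x}"
      using that by (intro finite_measure_mono) auto
    with that show ?thesis by (simp add: B_def)
  qed
  \<comment> \<open>The possible shapes of a downward closed set of reals. In each nonempty case the
    event that \<open>h\<close> takes values in \<open>B\<close> is covered by one event
    \<open>h x \<le> b\<close> with \<open>b \<in> B\<close>, or is an increasing countable union of
    such events, so \<open>low\<close> and continuity from below give the bound. A largest element
    is handled directly, which avoids proving right continuity of the exceedance
    probability.\<close>
  consider "B = {}" | "B = UNIV" | m where "m \<in> B" "\<And>b. b \<in> B \<Longrightarrow> b \<le> m"
    | s where "B = {..<s}"
  proof (cases "B = {} \<or> \<not> bdd_above B")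
    case True
    have unbdd: "B = UNIV" if "\<not> bdd_above B"
    proof -
      have "\<exists>b\<in>B. c \<le> b" for c
        using that by (meson bdd_above.I linear)
      then show ?thesis using down by blast
    qed
    from True show ?thesis by (elim disjE) (auto intro: that(1,2) dest: unbdd)
  next
    case False
    then have ub: "b \<le> Sup B" if "b \<in> B" for b
      using that by (simp add: cSup_upper)
    show ?thesis
    proof (cases "Sup B \<in> B")
      case True
      then show ?thesis using that(3) ub by blast
    next
      case notin: False
      have "B = {..<Sup B}"
      proof (intro equalityI subsetI)
        fix b assume "b \<in> B"
        then show "b \<in> {..<Sup B}" using ub notin by (metis lessThan_iff order_le_less)
      next
        fix b assume "b \<in> {..<Sup B}"
        then obtain c where "c \<in> B" "b < c"
          using False by (auto simp: less_cSup_iff)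
        then show "b \<in> B" using down by force
      qed
      then show ?thesis using that(4) by blast
    qed
  qed
  then have "prob A \<le> 1 - \<epsilon>"
  proof cases
    case 1
    then show ?thesis using \<open>\<epsilon> \<le> 1\<close> by (simp add: A_def)
  next
    case 2
    have "(\<lambda>n. prob {x \<in> space M. h x \<le> real n}) \<longlonglongrightarrow> prob (\<Union>n. {x \<in> space M. h x \<le> real n})"
      by (intro finite_Lim_measure_incseq) (auto simp: incseq_def intro: order_trans)
    moreover have "(\<Union>n. {x \<in> space M. h x \<le> real n}) = A"
      using 2 real_arch_simple by (auto simp: A_def)
    ultimately show ?thesis
      using low 2 by (intro LIMSEQ_le_const2) auto
  next
    case (3 m)
    have "prob A \<le> prob {x \<in> space M. h x \<le> m}"
      using 3 by (intro finite_measure_mono) (auto simp: A_def)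
    then show ?thesis using low[OF 3(1)] by simp
  next
    case (4 s)
    have "(\<lambda>n. prob {x \<in> space M. h x \<le> s - 1 / Suc n})
        \<longlonglongrightarrow> prob (\<Union>n. {x \<in> space M. h x \<le> s - 1 / Suc n})"
    proof (intro finite_Lim_measure_incseq)
      show "incseq (\<lambda>n. {x \<in> space M. h x \<le> s - 1 / real (Suc n)})"
        unfolding incseq_def
      proof (intro allI impI subsetI CollectI conjI)
        fix m n x assume "m \<le> n" "x \<in> {x \<in> space M. h x \<le> s - 1 / real (Suc m)}"
        moreover from \<open>m \<le> n\<close> have "1 / real (Suc n) \<le> 1 / real (Suc m)"
          by (intro divide_left_mono) auto
        ultimately show "x \<in> space M" "h x \<le> s - 1 / real (Suc n)" by auto
      qed
    qed auto
    moreover have "(\<Union>n. {x \<in> space M. h x \<le> s - 1 / real (Suc n)}) = A"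
    proof -
      have "(\<exists>n. y \<le> s - 1 / real (Suc n)) \<longleftrightarrow> y < s" for y
      proof
        assume "y < s"
        then obtain n where "inverse (real (Suc n)) < s - y"
          using reals_Archimedean[of "s - y"] by auto
        then show "\<exists>n. y \<le> s - 1 / real (Suc n)"
          by (intro exI[of _ n]) (simp add: inverse_eq_divide)
      next
        assume "\<exists>n. y \<le> s - 1 / real (Suc n)"
        then obtain n where "y \<le> s - 1 / real (Suc n)" by blast
        moreover have "0 < 1 / real (Suc n)" by simp
        ultimately show "y < s" by linarith
      qed
      then show ?thesis using 4 by (auto simp: A_def)
    qed
    ultimately show ?thesis
      using low 4 by (intro LIMSEQ_le_const2) auto
  qed
  then show ?thesis by (simp add: A_def)
qed

text \<open>An antitone function is Borel. This makes the set of samples with a small exceedance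
  probability at their maximum an event.\<close>

lemma (in prob_space) borel_measurable_exceedance:
  fixes h :: "'a \<Rightarrow> real"
  assumes [measurable]: "h \<in> borel_measurable M"
  shows "(\<lambda>d. prob {x \<in> space M. d < h x}) \<in> borel_measurable borel"
proof -
  have "mono (\<lambda>d. - prob {x \<in> space M. d < h x})"
    by (intro monoI le_imp_neg_le finite_measure_mono) auto
  then have "(\<lambda>d. - prob {x \<in> space M. d < h x}) \<in> borel_measurable borel"
    by (rule borel_measurable_mono)
  then show ?thesis by simp
qed

lemma borel_measurable_sample_max [measurable]:
  fixes h :: "'a \<Rightarrow> real"
  assumes [measurable]: "h \<in> borel_measurable M"
  shows "(\<lambda>w. Max (insert 0 (h ` w ` {..<N::nat}))) \<in> borel_measurable (Pi\<^sub>M {..<N} (\<lambda>_. M))"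
proof -
  \<comment> \<open>The set under \<open>Max\<close> varies with \<open>w\<close>; indexing by
    options, with \<open>None\<close> carrying the value 0, turns it into a maximum of measurable
    functions over a fixed finite index set.\<close>
  have "Max (insert 0 (h ` w ` {..<N})) =
      Max ((\<lambda>i. case i of None \<Rightarrow> 0 | Some j \<Rightarrow> h (w j)) ` insert None (Some ` {..<N}))" for w
    by (simp add: image_image)
  moreover have "(\<lambda>w. Max ((\<lambda>i. case i of None \<Rightarrow> 0 | Some j \<Rightarrow> h (w j)) ` insert None (Some ` {..<N})))
      \<in> borel_measurable (Pi\<^sub>M {..<N} (\<lambda>_. M))"
    by (intro borel_measurable_Max) auto
  ultimately show ?thesis by simp
qed

text \<open>Exceedance probabilities are antitone, so one above \<epsilon> at the sample maximum is
  also above \<epsilon> at every sampled value. The bad samples thus lie in a box with all sides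
  equal to \<open>A\<close>, whose probability factors by independence.\<close>

lemma (in prob_space) sample_max_exceedance:
  fixes h :: "'a \<Rightarrow> real"
  assumes [measurable]: "h \<in> borel_measurable M"
    and nonneg: "\<And>x. x \<in> space M \<Longrightarrow> 0 \<le> h x"
    and "0 \<le> (1 - \<epsilon>) ^ N"
  defines "D \<equiv> \<lambda>w. Max (insert 0 (h ` w ` {..<N}))"
  shows "1 - (1 - \<epsilon>) ^ N \<le> measure (Pi\<^sub>M {..<N} (\<lambda>_. M))
      {w \<in> space (Pi\<^sub>M {..<N} (\<lambda>_. M)). prob {x \<in> space M. D w < h x} \<le> \<epsilon>}"
proof -
  interpret P: product_prob_space "\<lambda>_. M" "{..<N}" by unfold_locales
  let ?P = "Pi\<^sub>M {..<N} (\<lambda>_. M)"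
  note [measurable] = borel_measurable_exceedance[OF assms(1)]
  have [measurable]: "D \<in> borel_measurable ?P" unfolding D_def by measurable
  show ?thesis
  \<comment> \<open>For \<open>1 \<le> \<epsilon>\<close> every sample is good and the assumed sign
    of the power suffices; for \<open>N = 0\<close> the left side is 0.\<close>
  proof (cases "1 \<le> \<epsilon> \<or> N = 0")
    case True
    then show ?thesis
    proof
      assume "1 \<le> \<epsilon>"
      then have "prob S \<le> \<epsilon>" for S using prob_le_1 order_trans by blast
      then show ?thesis using assms(3) by (simp add: P.P.prob_space)
    qed simp
  next
    case False
    define B where "B = {d. \<epsilon> < prob {x \<in> space M. d < h x}}"
    define A where "A = {x \<in> space M. h x \<in> B}"
    have [measurable]: "A \<in> events" unfolding A_def B_def by measurable
    have bad: "{w \<in> space ?P. \<not> prob {x \<in> space M. D w < h x} \<le> \<epsilon>} \<subseteq> {..<N} \<rightarrow>\<^sub>E A"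
    proof
      fix w assume w: "w \<in> {w \<in> space ?P. \<not> prob {x \<in> space M. D w < h x} \<le> \<epsilon>}"
      have "w i \<in> A" if "i < N" for i
      proof -
        have "h (w i) \<le> D w" unfolding D_def using that by (intro Max_ge) auto
        then have "prob {x \<in> space M. D w < h x} \<le> prob {x \<in> space M. h (w i) < h x}"
          by (intro finite_measure_mono) auto
        then show ?thesis using w that by (auto simp: A_def B_def space_PiM)
      qed
      then show "w \<in> {..<N} \<rightarrow>\<^sub>E A" using w by (auto simp: space_PiM PiE_iff)
    qed
    have "measure ?P {w \<in> space ?P. \<not> prob {x \<in> space M. D w < h x} \<le> \<epsilon>}
        \<le> measure ?P ({..<N} \<rightarrow>\<^sub>E A)"
      using bad by (intro P.P.finite_measure_mono) auto
    also have "\<dots> = prob A ^ N"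
    proof -
      interpret F: finite_product_prob_space "\<lambda>_. M" "{..<N}" by unfold_locales simp
      show ?thesis by (subst F.prob_times) auto
    qed
    also have "\<dots> \<le> (1 - \<epsilon>) ^ N"
      using prob_exceedance_levels[OF assms(1), of \<epsilon>] False
      by (intro power_mono) (auto simp: A_def B_def)
    finally show ?thesis by (subst (asm) P.P.prob_neg) auto
  qed
qed

section \<open>The estimate, the optimal level and the uniform measure\<close>

text \<open>An intersection of preimages of \<open>X\<close> under continuous iterates of
  \<open>f\<close>. Closedness is what makes the estimate Borel.\<close>

lemma closed_stay_set:
  assumes "continuous_on UNIV f" "closed X"
  shows "closed (stay_set f X k)"
proof -
  have cont: "continuous_on UNIV (trajectory f l)" for l
    unfolding trajectory_def
  proof (induction l)
    case (Suc l)
    then show ?case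
      using continuous_on_compose[OF Suc continuous_on_subset[OF assms(1)]] by (simp add: comp_def)
  qed (simp add: continuous_on_id)
  have "stay_set f X k = X \<inter> (\<Inter>l\<in>{1..k}. trajectory f l -` X)"
    by (auto simp: stay_set_def)
  then show ?thesis
    using assms(2) cont by (auto intro!: closed_Int closed_INT closed_vimage)
qed

text \<open>The feasible levels form a closed half line, whose left end is the maximum. The inserted
  0 is the sign constraint and also settles the empty sample.\<close>

lemma delta_star_eq_Max:
  assumes "finite S"
  shows "delta_star f X \<omega> R S = Max (insert 0 (h_fun f X \<omega> R ` S))"
  unfolding delta_star_def using assms
  by (intro Least_equality) auto

lemma sets_unif [measurable_cong]: "sets (unif X) = sets (restrict_space borel X)"
  by (simp add: unif_def sets_restrict_space)

lemma space_unif: "space (unif X) = X"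
  by (simp add: unif_def space_restrict_space)

lemma prob_space_unif:
  fixes X :: "'a::euclidean_space set"
  assumes "compact X" "0 < emeasure lborel X"
  shows "prob_space (unif X)"
proof -
  have "X \<in> sets borel" using assms by (simp add: borel_compact)
  moreover have "emeasure lborel X < \<infinity>"
    using emeasure_compact_finite[OF assms(1)] by simp
  ultimately show ?thesis
    unfolding unif_def using assms
    by (intro prob_space_uniform_measure) (auto simp: emeasure_restrict_space)
qed

lemma sets_unif_I:
  assumes "S \<in> sets borel" "S \<subseteq> X"
  shows "S \<in> sets (unif X)"
  using assms by (auto simp: sets_unif sets_restrict_space)

section \<open>Comparing the distances to two finite reference sets\<close>

lemma borel_dist_cmp_set:
  fixes X :: "'a::euclidean_space set"
  assumes [measurable]: "X \<in> sets borel" and "finite S" "finite T"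
  shows "dist_cmp_set X S T r \<in> sets borel"
proof -
  have [measurable]: "(\<lambda>x. INF y\<in>S. ereal (norm (y - x))) \<in> borel_measurable borel"
    if "finite S" for S :: "'a set"
    using that by (intro borel_measurable_INF) (auto simp: countable_finite)
  note [measurable] = this[OF assms(2)] this[OF assms(3)]
  show ?thesis unfolding dist_cmp_set_def by measurable
qed

lemma dist_cmp_set_mono:
  "r \<le> s \<Longrightarrow> dist_cmp_set X S T r \<subseteq> dist_cmp_set X S T s"
  by (auto simp: dist_cmp_set_def elim!: order_trans)

lemma INF_norm_eq_Min:
  assumes "finite S" "S \<noteq> {}"
  shows "(INF y\<in>S. ereal (norm (y - x))) = ereal (Min ((\<lambda>y. norm (y - x)) ` S))"
proof (rule antisym)
  have "Min ((\<lambda>y. norm (y - x)) ` S) \<in> (\<lambda>y. norm (y - x)) ` S"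
    using assms by (intro Min_in) auto
  then show "(INF y\<in>S. ereal (norm (y - x))) \<le> ereal (Min ((\<lambda>y. norm (y - x)) ` S))"
    by (auto intro: INF_lower2)
  show "ereal (Min ((\<lambda>y. norm (y - x)) ` S)) \<le> (INF y\<in>S. ereal (norm (y - x)))"
    using assms by (intro INF_greatest) auto
qed

text \<open>For empty \<open>T\<close> the second infimum is \<infinity> while the first is finite,
  so the difference is -\<infinity> and every point qualifies.\<close>

lemma dist_cmp_set_iff:
  assumes "finite S" "finite T" "S \<noteq> {}" "x \<in> X"
  shows "x \<in> dist_cmp_set X S T r \<longleftrightarrow>
    T = {} \<or> Min ((\<lambda>y. norm (y - x)) ` S) - Min ((\<lambda>y. norm (y - x)) ` T) \<le> r"
  using assms by (cases "T = {}") (auto simp: dist_cmp_set_def INF_norm_eq_Min top_ereal_def)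

lemma est_set_subset: "est_set f X \<omega> \<subseteq> X"
  by (auto simp: est_set_def stay_set_def)

text \<open>On the estimate \<open>h_fun\<close> is the inner distance. Missing the comparison set
  means that it exceeds the outer distance by more than \<open>r\<close>, and the outer distance is
  nonnegative.\<close>

lemma h_fun_gt_of_mem_est_set:
  assumes "finite R" "x \<in> est_set f X \<omega>" "ref_in f X \<omega> R \<noteq> {}"
    and "x \<notin> dist_cmp_set X (ref_in f X \<omega> R) (ref_out f X \<omega> R) r"
  shows "r < h_fun f X \<omega> R x"
proof -
  have fin: "finite (ref_in f X \<omega> R)" "finite (ref_out f X \<omega> R)"
    using assms(1) by (auto simp: ref_in_def ref_out_def)
  have x: "x \<in> X" using assms(2) by (rule subsetD[OF est_set_subset])
  have "ref_out f X \<omega> R \<noteq> {} \<and> r < Min ((\<lambda>y. norm (y - x)) ` ref_in f X \<omega> R)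
      - Min ((\<lambda>y. norm (y - x)) ` ref_out f X \<omega> R)"
    using assms(4) unfolding dist_cmp_set_iff[OF fin assms(3) x] de_Morgan_disj not_le .
  then have ne: "ref_out f X \<omega> R \<noteq> {}"
    and r: "r < Min ((\<lambda>y. norm (y - x)) ` ref_in f X \<omega> R)
      - Min ((\<lambda>y. norm (y - x)) ` ref_out f X \<omega> R)" by blast+
  have "0 \<le> Min ((\<lambda>y. norm (y - x)) ` ref_out f X \<omega> R)"
    using fin ne by simp
  with r show ?thesis using assms(2) by (simp add: h_fun_def)
qed

text \<open>The inequality is strict because \<open>x\<close>, lying outside the estimate, has positive distance
  to the inner reference points.\<close>

lemma h_fun_gt_of_notin_est_set:
  assumes "finite R" "x \<in> X" "x \<notin> est_set f X \<omega>" "ref_out f X \<omega> R \<noteq> {}"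
    and "x \<in> dist_cmp_set X (ref_in f X \<omega> R) (ref_out f X \<omega> R) (- r)"
  shows "r < h_fun f X \<omega> R x"
proof -
  have fin: "finite (ref_in f X \<omega> R)" "finite (ref_out f X \<omega> R)"
    using assms(1) by (auto simp: ref_in_def ref_out_def)
  \<comment> \<open>Without inner points the first infimum is \<infinity> and the second is finite,
    so no real level could bound the difference.\<close>
  have ne: "ref_in f X \<omega> R \<noteq> {}"
    using assms(5) fin assms(4)
    by (auto simp: dist_cmp_set_def INF_norm_eq_Min top_ereal_def)
  have r: "Min ((\<lambda>y. norm (y - x)) ` ref_in f X \<omega> R)
      - Min ((\<lambda>y. norm (y - x)) ` ref_out f X \<omega> R) \<le> - r"
    using assms(4,5) dist_cmp_set_iff[OF fin ne assms(2), of "- r"] by auto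
  have "0 < Min ((\<lambda>y. norm (y - x)) ` ref_in f X \<omega> R)"
    using fin ne assms(3) by (auto simp: ref_in_def)
  with r show ?thesis using assms(2,3) by (simp add: h_fun_def)
qed

section \<open>The confidence bound for the measure of the estimate\<close>

theorem theorem4:
  fixes f :: "real ^ 'n \<Rightarrow> real ^ 'n"
    and X \<omega> R :: "(real ^ 'n) set"
    and N :: nat
    and \<epsilon> \<beta> :: real
  assumes "continuous_on UNIV f"
    and "compact X"
    and "0 < emeasure lborel X"
    and "finite \<omega>" and "\<omega> \<noteq> {}" and "\<omega> \<subseteq> X"
    and "finite R" and "R \<subseteq> X"
    and "est_set f X \<omega> \<noteq> {} \<Longrightarrow> ref_in f X \<omega> R \<noteq> {}"
    and "X - est_set f X \<omega> \<noteq> {} \<Longrightarrow> ref_out f X \<omega> R \<noteq> {}"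
    and "0 < \<epsilon>"
    and "\<beta> = (1 - \<epsilon>) ^ N"
    and "0 \<le> \<beta>"
  shows "measure (Pi\<^sub>M {..<N} (\<lambda>_. unif X))
      {w \<in> {..<N} \<rightarrow>\<^sub>E X.
         measure (unif X) (chi_lower f X \<omega> R (w ` {..<N})) - \<epsilon> \<le> measure (unif X) (est_set f X \<omega>) \<and>
         measure (unif X) (est_set f X \<omega>) \<le> measure (unif X) (chi_upper f X \<omega> R (w ` {..<N})) + \<epsilon>}
    \<ge> 1 - \<beta>"
proof -
  interpret U: prob_space "unif X" using assms(2,3) by (rule prob_space_unif)
  interpret P: product_prob_space "\<lambda>_. unif X" "{..<N}" by unfold_locales
  let ?P = "Pi\<^sub>M {..<N} (\<lambda>_. unif X)"
  define E I O' h where "E = est_set f X \<omega>" and "I = ref_in f X \<omega> R" and "O' = ref_out f X \<omega> R"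
    and "h = h_fun f X \<omega> R"
  \<comment> \<open>The sample enters only through the level \<open>D w\<close>; \<open>L\<close>
    and \<open>H\<close> are the measures of the lower and upper sets at a deterministic
    level.\<close>
  define D where "D = (\<lambda>w. Max (insert 0 (h ` w ` {..<N})))"
  define L where "L = (\<lambda>d. measure (unif X) (E \<union> dist_cmp_set X I O' (- d)))"
  define H where "H = (\<lambda>d. measure (unif X) (E \<inter> dist_cmp_set X I O' d))"
  have fin: "finite I" "finite O'" using assms(7) by (auto simp: I_def O'_def ref_in_def ref_out_def)
  have [measurable]: "X \<in> sets borel" using assms(2) by (simp add: borel_compact)
  have [measurable]: "E \<in> sets borel"
    using closed_stay_set[OF assms(1) compact_imp_closed[OF assms(2)]]
    by (auto simp: E_def est_set_def)
  have EX: "E \<subseteq> X" unfolding E_def by (rule est_set_subset)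
  have E_sets: "E \<in> sets (unif X)" using EX by (intro sets_unif_I) auto
  have D_sets: "dist_cmp_set X I O' d \<in> sets (unif X)" for d
    using borel_dist_cmp_set[OF \<open>X \<in> sets borel\<close> fin]
    by (intro sets_unif_I) (auto simp: dist_cmp_set_def)
  have "h \<in> borel_measurable borel"
  proof -
    have "(\<lambda>x. Min ((\<lambda>y. norm (y - x)) ` S)) \<in> borel_measurable borel" if "finite S"
      for S :: "(real ^ 'n) set"
      using that by (intro borel_measurable_Min) auto
    note [measurable] = this[OF fin(1)] this[OF fin(2)]
    have "h = (\<lambda>x. indicator E x * Min ((\<lambda>y. norm (y - x)) ` I) +
        indicator (X - E) x * Min ((\<lambda>y. norm (y - x)) ` O'))"
      by (simp add: fun_eq_iff h_def h_fun_def E_def I_def O'_def)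
    then show ?thesis by simp
  qed
  then have h_meas [measurable]: "h \<in> borel_measurable (unif X)"
    by (simp add: measurable_restrict_space1 cong: measurable_cong_sets[OF sets_unif refl])
  \<comment> \<open>\<open>Min\<close> of the empty set is unspecified, so the sign needs the
    reference set of the branch chosen by the indicator to be nonempty.\<close>
  have h_nonneg: "0 \<le> h x" if "x \<in> space (unif X)" for x
  proof (cases "x \<in> E")
    case True
    then have "I \<noteq> {}" using assms(9) by (auto simp: E_def I_def)
    then show ?thesis using True fin
      by (simp add: h_def h_fun_def E_def[symmetric] I_def[symmetric])
  next
    case False
    then have "O' \<noteq> {}" using assms(10) that by (auto simp: E_def O'_def space_unif)
    then show ?thesis using False fin
      by (simp add: h_def h_fun_def E_def[symmetric] O'_def[symmetric])
  qed
  \<comment> \<open>Monotonicity in the level makes \<open>H\<close> and, after a sign change,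
    \<open>L\<close> Borel; composed with \<open>D\<close> they make the event of the claim
    measurable.\<close>
  have "mono H"
    unfolding H_def using E_sets D_sets
    by (intro monoI U.finite_measure_mono Int_mono dist_cmp_set_mono) auto
  then have [measurable]: "H \<in> borel_measurable borel" by (rule borel_measurable_mono)
  have "mono (\<lambda>d. - L d)"
    unfolding L_def using E_sets D_sets
    by (intro monoI le_imp_neg_le U.finite_measure_mono Un_mono dist_cmp_set_mono) auto
  then have "(\<lambda>d. - L d) \<in> borel_measurable borel" by (rule borel_measurable_mono)
  then have [measurable]: "L \<in> borel_measurable borel" by simp
  have [measurable]: "D \<in> borel_measurable ?P" unfolding D_def by measurable
  have chi: "measure (unif X) (chi_lower f X \<omega> R (w ` {..<N})) = L (D w)"
      "measure (unif X) (chi_upper f X \<omega> R (w ` {..<N})) = H (D w)" for w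
    by (simp_all add: chi_lower_def chi_upper_def L_def H_def D_def E_def I_def O'_def h_def
        delta_star_eq_Max)
  \<comment> \<open>Both error sets, the lower set minus \<open>E\<close> and \<open>E\<close> minus
    the upper set, lie in \<open>V d\<close>. The union bound then yields \<open>lower\<close> and
    \<open>upper\<close> at every fixed level.\<close>
  define V where "V = (\<lambda>d. {x \<in> space (unif X). d < h x})"
  have V_sets: "V d \<in> sets (unif X)" for d unfolding V_def by measurable
  have lower: "L d \<le> measure (unif X) E + measure (unif X) (V d)" for d
  proof -
    have "E \<union> dist_cmp_set X I O' (- d) \<subseteq> E \<union> V d"
    proof
      fix x assume x: "x \<in> E \<union> dist_cmp_set X I O' (- d)"
      show "x \<in> E \<union> V d"
      proof (cases "x \<in> E")
        case False
        with x have "x \<in> X" "x \<in> dist_cmp_set X I O' (- d)" by (auto simp: dist_cmp_set_def)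
        moreover from this have "O' \<noteq> {}" using False assms(10) by (auto simp: E_def O'_def)
        ultimately have "d < h x"
          using False assms(7) h_fun_gt_of_notin_est_set
          unfolding E_def I_def O'_def h_def by blast
        then show ?thesis using \<open>x \<in> X\<close> by (simp add: V_def space_unif)
      qed simp
    qed
    then have "L d \<le> measure (unif X) (E \<union> V d)"
      unfolding L_def using E_sets V_sets by (intro U.finite_measure_mono) auto
    also have "\<dots> \<le> measure (unif X) E + measure (unif X) (V d)"
      using E_sets V_sets by (intro measure_Un_le)
    finally show ?thesis .
  qed
  have upper: "measure (unif X) E \<le> H d + measure (unif X) (V d)" for d
  proof -
    have "E \<subseteq> (E \<inter> dist_cmp_set X I O' d) \<union> V d"
    proof
      fix x assume x: "x \<in> E"
      then have "I \<noteq> {}" using assms(9) by (auto simp: E_def I_def)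
      then have "d < h x" if "x \<notin> dist_cmp_set X I O' d"
        using x that assms(7) h_fun_gt_of_mem_est_set
        unfolding E_def I_def O'_def h_def by blast
      then show "x \<in> (E \<inter> dist_cmp_set X I O' d) \<union> V d"
        using x EX by (auto simp: V_def space_unif)
    qed
    then have "measure (unif X) E \<le> measure (unif X) ((E \<inter> dist_cmp_set X I O' d) \<union> V d)"
      using E_sets V_sets D_sets by (intro U.finite_measure_mono) auto
    also have "\<dots> \<le> H d + measure (unif X) (V d)"
      unfolding H_def using E_sets V_sets D_sets by (intro measure_Un_le) auto
    finally show ?thesis .
  qed
  have "1 - \<beta> \<le> measure ?P {w \<in> space ?P. measure (unif X) (V (D w)) \<le> \<epsilon>}"
    using U.sample_max_exceedance[OF h_meas h_nonneg, of \<epsilon> N] assms(12,13)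
    by (simp add: V_def D_def)
  \<comment> \<open>A single event controls both inequalities: the deterministic bounds are taken at
    \<open>d = D w\<close>, so the failure probability is not split between the two sides.\<close>
  also have "\<dots> \<le> measure ?P {w \<in> space ?P. L (D w) - \<epsilon> \<le> measure (unif X) E \<and>
      measure (unif X) E \<le> H (D w) + \<epsilon>}"
  proof (intro P.P.finite_measure_mono)
    show "{w \<in> space ?P. measure (unif X) (V (D w)) \<le> \<epsilon>} \<subseteq>
      {w \<in> space ?P. L (D w) - \<epsilon> \<le> measure (unif X) E \<and> measure (unif X) E \<le> H (D w) + \<epsilon>}"
    proof safe
      fix w assume "measure (unif X) (V (D w)) \<le> \<epsilon>"
      then show "L (D w) - \<epsilon> \<le> measure (unif X) E" "measure (unif X) E \<le> H (D w) + \<epsilon>"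
        using lower[of "D w"] upper[of "D w"] by linarith+
    qed
  qed measurable
  finally show ?thesis
    by (simp add: chi space_PiM space_unif E_def)
qed

end
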